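(* Let $G$ be a finite simple graph that is $\{2K_2, K_1+C_4\}$-free and satisfies $\omega(G)\geq 3$. Then $\chi(G)\leq \omega(G)+1$.
   Context: $\chi(G)$ is the chromatic number and $\omega(G)$ the clique number of $G$. $2K_2$ is the disjoint union of two edges. For graphs $G_1,G_2$, the join $G_1+G_2$ is their disjoint union together with all edges between $V(G_1)$ and $V(G_2)$; thus $K_1+C_4$ is the wheel on five vertices (a $4$-cycle plus a vertex adjacent to all four cycle vertices). A graph is $\mathcal{F}$-free if it has no induced subgraph isomorphic to a member of $\mathcal{F}$. *)

theory Defs
  imports "Graph_Theory.Graph_Theory"
begin

text \<open>
  A finite simple graph is a \<^locale>\<open>graph\<close> of the AFP entry Graph_Theory: a finite loop-free
  digraph without parallel arcs whose arc relation is symmetric, so that an undirected edge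
  \<open>uv\<close> is the pair of arcs \<open>(u,v)\<close>, \<open>(v,u)\<close>.
\<close>

definition complete_graph :: "nat \<Rightarrow> nat pair_pre_digraph" where
  "complete_graph n = \<lparr> pverts = {..<n}, parcs = {(u, v). u < n \<and> v < n \<and> u \<noteq> v} \<rparr>"

text \<open>Only meaningful for \<open>n \<ge> 3\<close> (for \<open>n = 1\<close> the vertex would carry a loop).\<close>

definition cycle_graph :: "nat \<Rightarrow> nat pair_pre_digraph" where
  "cycle_graph n = \<lparr> pverts = {..<n},
     parcs = {(u, v). u < n \<and> v < n \<and> (v = Suc u mod n \<or> u = Suc v mod n)} \<rparr>"

definition disjoint_union ::
    "'a pair_pre_digraph \<Rightarrow> 'b pair_pre_digraph \<Rightarrow> ('a + 'b) pair_pre_digraph" where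
  "disjoint_union G H = \<lparr> pverts = pverts G <+> pverts H,
     parcs = map_prod Inl Inl ` parcs G \<union> map_prod Inr Inr ` parcs H \<rparr>"

definition graph_join ::
    "'a pair_pre_digraph \<Rightarrow> 'b pair_pre_digraph \<Rightarrow> ('a + 'b) pair_pre_digraph" where
  "graph_join G H = \<lparr> pverts = pverts (disjoint_union G H),
     parcs = parcs (disjoint_union G H)
       \<union> (Inl ` pverts G) \<times> (Inr ` pverts H) \<union> (Inr ` pverts H) \<times> (Inl ` pverts G) \<rparr>"

definition two_K2 :: "(nat + nat) pair_pre_digraph" where
  "two_K2 = disjoint_union (complete_graph 2) (complete_graph 2)"

definition K1_join_C4 :: "(nat + nat) pair_pre_digraph" where
  "K1_join_C4 = graph_join (complete_graph 1) (cycle_graph 4)"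

definition free_of :: "'c pair_pre_digraph set \<Rightarrow> ('a, 'b) pre_digraph \<Rightarrow> bool" where
  "free_of \<F> G \<longleftrightarrow> \<not> (\<exists>H. induced_subgraph H G \<and> (\<exists>F\<in>\<F>. digraph_iso H (with_proj F)))"

definition clique :: "('a, 'b) pre_digraph \<Rightarrow> 'a set \<Rightarrow> bool" where
  "clique G C \<longleftrightarrow> C \<subseteq> verts G \<and> (\<forall>u\<in>C. \<forall>v\<in>C. u \<noteq> v \<longrightarrow> u \<rightarrow>\<^bsub>G\<^esub> v)"

definition clique_number :: "('a, 'b) pre_digraph \<Rightarrow> nat" where
  "clique_number G = Max {card C |C. clique G C}"

definition proper_colouring :: "('a, 'b) pre_digraph \<Rightarrow> nat \<Rightarrow> ('a \<Rightarrow> nat) \<Rightarrow> bool" where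
  "proper_colouring G k c \<longleftrightarrow>
     c ` verts G \<subseteq> {..<k} \<and> (\<forall>u v. u \<rightarrow>\<^bsub>G\<^esub> v \<longrightarrow> c u \<noteq> c v)"

definition chromatic_number :: "('a, 'b) pre_digraph \<Rightarrow> nat" where
  "chromatic_number G = (LEAST k. \<exists>c. proper_colouring G k c)"

text \<open>
  The maximum and the minimum above are attained on every finite simple graph, and the two
  forbidden graphs are finite simple graphs.
\<close>

lemma (in graph) clique_number_attained: "\<exists>C. clique G C \<and> card C = clique_number G"
proof -
  have "{card C |C. clique G C} \<subseteq> card ` Pow (verts G)"
    by (auto simp: clique_def)
  then have "finite {card C |C. clique G C}"
    by (rule finite_subset) simp
  moreover have "{card C |C. clique G C} \<noteq> {}"
    by (auto simp: clique_def)
  ultimately have "clique_number G \<in> {card C |C. clique G C}"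
    unfolding clique_number_def by (rule Max_in)
  then show ?thesis by auto
qed

lemma (in graph) chromatic_number_attained: "\<exists>c. proper_colouring G (chromatic_number G) c"
proof -
  obtain c :: "'a \<Rightarrow> nat" where c: "c ` verts G = {i. i < card (verts G)}" "inj_on c (verts G)"
    using finite_imp_inj_to_nat_seg[of "verts G"] finite_verts
    by (metis card_image card_Collect_less_nat)
  have "c u \<noteq> c v" if "u \<rightarrow>\<^bsub>G\<^esub> v" for u v
    using that c(2) no_loops by (auto simp: arcs_ends_conv dest!: inj_onD)
  with c(1) have "proper_colouring G (card (verts G)) c"
    by (auto simp: proper_colouring_def)
  then show ?thesis
    unfolding chromatic_number_def by (rule_tac LeastI) blast
qed

lemma pair_graph_two_K2: "pair_graph two_K2"
  by unfold_locales
    (auto simp: two_K2_def disjoint_union_def complete_graph_def symmetric_def sym_def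
      map_prod_def image_iff
      intro: finite_subset[of _ "{..<2} \<times> {..<2}"])

lemma pair_graph_K1_join_C4: "pair_graph K1_join_C4"
  by unfold_locales
    (auto simp: K1_join_C4_def graph_join_def disjoint_union_def complete_graph_def
      cycle_graph_def symmetric_def sym_def map_prod_def image_iff mod_Suc split: if_splits
      intro: finite_subset[of _ "{..<4} \<times> {..<4}"])

end

theory Submission
  imports Defs
begin

text \<open>
  Fix a maximum clique \<open>A\<close> and let \<open>M x\<close> be the set of its vertices not adjacent to \<open>x\<close>. For
  adjacent \<open>x\<close>, \<open>y\<close> outside \<open>A\<close>, \<open>2K\<^sub>2\<close>-freeness gives \<open>card (M x \<inter> M y) \<le> 1\<close>, and
  \<open>K\<^sub>1 + C\<^sub>4\<close>-freeness gives \<open>M x \<union> M y = A\<close> unless \<open>M x\<close> and \<open>M y\<close> are comparable.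
  Hence the vertices with \<open>card (M x) = 1\<close> are independent, and they all receive one extra colour.
  Arrange \<open>A\<close>, coloured injectively, in a cyclic order. A vertex with \<open>card (M x) \<ge> 2\<close> receives
  the colour of some \<open>c \<in> M x\<close> whose cyclic successor is not in \<open>M x\<close> (any \<open>c\<close> if \<open>M x = A\<close>). Two
  adjacent such vertices satisfy \<open>M x \<union> M y = A\<close>, so they cannot share \<open>c\<close>, whose successor
  lies in \<open>M x\<close> or in \<open>M y\<close>.
\<close>

section \<open>Embeddings as induced subgraphs\<close>

text \<open>The isomorphism is the inverse of \<open>f\<close> on vertices. Arcs of
  \<open>with_proj F\<close> are pairs of vertices, so an arc goes to the pair of preimages of its
  ends; this is injective because there are no parallel arcs.\<close>

lemma (in nomulti_digraph) digraph_iso_induce_subgraph: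
  assumes inj: "inj_on f (pverts F)" and arcs: "parcs F \<subseteq> pverts F \<times> pverts F"
    and adj: "\<And>u v. \<lbrakk>u \<in> pverts F; v \<in> pverts F\<rbrakk> \<Longrightarrow> (u, v) \<in> parcs F \<longleftrightarrow> f u \<rightarrow>\<^bsub>G\<^esub> f v"
  shows "digraph_iso (G \<restriction> f ` pverts F) (with_proj F)"
proof -
  let ?H = "G \<restriction> f ` pverts F"
  let ?g = "the_inv_into (pverts F) f"
  let ?h = "\<lparr>iso_verts = ?g, iso_arcs = \<lambda>e. (?g (tail G e), ?g (head G e)),
    iso_head = snd, iso_tail = fst\<rparr>"
  have g: "?g (f u) = u" if "u \<in> pverts F" for u
    using inj that by (rule the_inv_into_f_f)
  have inj_g: "inj_on ?g (f ` pverts F)"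
    using inj by (rule inj_on_the_inv_into)
  have "inj_on (\<lambda>e. (?g (tail G e), ?g (head G e))) (arcs ?H)"
  proof (rule inj_onI)
    fix e e' assume e: "e \<in> arcs ?H" "e' \<in> arcs ?H"
      and "(?g (tail G e), ?g (head G e)) = (?g (tail G e'), ?g (head G e'))"
    then have "tail G e = tail G e'" "head G e = head G e'"
      using inj_g by (auto dest: inj_onD)
    with e show "e = e'"
      by (intro no_multi_arcs) (auto simp: arc_to_ends_def)
  qed
  then have iso: "pre_digraph.digraph_isomorphism ?H ?h"
    using inj_g by (auto simp: pre_digraph.digraph_isomorphism_def)
  have "(\<lambda>e. (?g (tail G e), ?g (head G e))) ` arcs ?H = parcs F"
  proof (intro equalityI subsetI)
    fix p assume "p \<in> (\<lambda>e. (?g (tail G e), ?g (head G e))) ` arcs ?H"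
    then obtain e u v where "e \<in> arcs G" "u \<in> pverts F" "v \<in> pverts F"
      "tail G e = f u" "head G e = f v" "p = (?g (f u), ?g (f v))"
      by auto
    then show "p \<in> parcs F"
      using adj[of u v] g by (force simp: arcs_ends_conv)
  next
    fix p assume p: "p \<in> parcs F"
    then obtain u v where uv: "p = (u, v)" "u \<in> pverts F" "v \<in> pverts F"
      using arcs by auto
    with p adj[of u v] obtain e where "e \<in> arcs G" "tail G e = f u" "head G e = f v"
      by (auto simp: arcs_ends_conv)
    with uv show "p \<in> (\<lambda>e. (?g (tail G e), ?g (head G e))) ` arcs ?H"
      using g by (auto intro!: image_eqI[of _ _ e])
  qed
  moreover have "?g ` f ` pverts F = pverts F"
    using g by (force simp: image_iff)
  ultimately have "with_proj F = app_iso ?h ?H"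
    by (simp add: app_iso_def with_proj_def)
  with iso show ?thesis
    unfolding digraph_iso_def by blast
qed

text \<open>Reduces finding a forbidden induced subgraph to comparing adjacencies along an explicit
  vertex map.\<close>

lemma (in nomulti_digraph) not_free_ofI:
  assumes "F \<in> \<F>" "inj_on f (pverts F)" "f ` pverts F \<subseteq> verts G"
    and "parcs F \<subseteq> pverts F \<times> pverts F"
    and "\<And>u v. \<lbrakk>u \<in> pverts F; v \<in> pverts F\<rbrakk> \<Longrightarrow> (u, v) \<in> parcs F \<longleftrightarrow> f u \<rightarrow>\<^bsub>G\<^esub> f v"
  shows "\<not> free_of \<F> G"
  using assms digraph_iso_induce_subgraph[of f F] induced_induce[of "f ` pverts F"]
  unfolding free_of_def by blast

section \<open>Local consequences of the forbidden subgraphs\<close>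

context graph
begin

lemma dominates_irrefl: "\<not> u \<rightarrow>\<^bsub>G\<^esub> u"
  using no_loops by (auto simp: arcs_ends_conv)

lemma dominates_commute: "u \<rightarrow>\<^bsub>G\<^esub> v \<longleftrightarrow> v \<rightarrow>\<^bsub>G\<^esub> u"
  using sym_arcs by (auto simp: symmetric_def dest: symD)

lemma two_K2_free_adjacent:
  assumes free: "free_of \<F> G" and "two_K2 \<in> \<F>" and "a \<rightarrow>\<^bsub>G\<^esub> b" "c \<rightarrow>\<^bsub>G\<^esub> d"
  shows "a \<rightarrow>\<^bsub>G\<^esub> c \<or> a \<rightarrow>\<^bsub>G\<^esub> d \<or> b \<rightarrow>\<^bsub>G\<^esub> c \<or> b \<rightarrow>\<^bsub>G\<^esub> d"
proof (rule ccontr)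
  assume nadj: "\<not> ?thesis"
  let ?f = "case_sum (\<lambda>i::nat. if i = 0 then a else b) (\<lambda>i::nat. if i = 0 then c else d)"
  have V: "pverts two_K2 = {Inl 0, Inl 1, Inr 0, Inr 1}"
    by (auto simp: two_K2_def disjoint_union_def complete_graph_def)
  have wf: "parcs two_K2 \<subseteq> pverts two_K2 \<times> pverts two_K2"
    by (auto simp: two_K2_def disjoint_union_def complete_graph_def)
  have E: "(Inl i, Inr j) \<notin> parcs two_K2" "(Inr i, Inl j) \<notin> parcs two_K2"
    "(Inl i, Inl j) \<in> parcs two_K2 \<longleftrightarrow> i < 2 \<and> j < 2 \<and> i \<noteq> j"
    "(Inr i, Inr j) \<in> parcs two_K2 \<longleftrightarrow> i < 2 \<and> j < 2 \<and> i \<noteq> j" for i j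
    by (auto simp: two_K2_def disjoint_union_def complete_graph_def image_iff)
  note edges = \<open>a \<rightarrow>\<^bsub>G\<^esub> b\<close> \<open>c \<rightarrow>\<^bsub>G\<^esub> d\<close>
  have non_edges: "\<not> a \<rightarrow>\<^bsub>G\<^esub> c" "\<not> a \<rightarrow>\<^bsub>G\<^esub> d" "\<not> b \<rightarrow>\<^bsub>G\<^esub> c" "\<not> b \<rightarrow>\<^bsub>G\<^esub> d"
    "\<not> c \<rightarrow>\<^bsub>G\<^esub> a" "\<not> d \<rightarrow>\<^bsub>G\<^esub> a" "\<not> c \<rightarrow>\<^bsub>G\<^esub> b" "\<not> d \<rightarrow>\<^bsub>G\<^esub> b"
    using nadj dominates_commute by blast+
  note adj = edges edges[THEN dominates_commute[THEN iffD1]] non_edges dominates_irrefl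
  \<comment> \<open>The two edges are disjoint: \<open>a = c\<close>, say, would turn the edge
    \<open>cd\<close> into the cross edge \<open>ad\<close>.\<close>
  have neq: "a \<noteq> b" "c \<noteq> d" "a \<noteq> c" "a \<noteq> d" "b \<noteq> c" "b \<noteq> d"
    using adj by metis+
  have "\<not> free_of \<F> G"
  proof (rule not_free_ofI[where f = ?f])
    show "inj_on ?f (pverts two_K2)"
      using neq by (auto simp: V inj_on_def)
    show "?f ` pverts two_K2 \<subseteq> verts G"
      using assms adj_in_verts by (auto simp: V)
    show "(u, v) \<in> parcs two_K2 \<longleftrightarrow> ?f u \<rightarrow>\<^bsub>G\<^esub> ?f v"
      if "u \<in> pverts two_K2" "v \<in> pverts two_K2" for u v
      using that adj unfolding V by (elim insertE emptyE) (simp_all add: E)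
  qed (use assms wf in auto)
  with free show False by blast
qed

text \<open>A chordless 4-cycle \<open>pqrs\<close> in the neighbourhood of \<open>z\<close> induces
  the wheel with hub \<open>z\<close>. Opposite cycle vertices are assumed distinct because their
  non-adjacency does not separate them.\<close>

lemma K1_join_C4_free_adjacent:
  assumes free: "free_of \<F> G" and "K1_join_C4 \<in> \<F>"
    and "p \<rightarrow>\<^bsub>G\<^esub> q" "q \<rightarrow>\<^bsub>G\<^esub> r" "r \<rightarrow>\<^bsub>G\<^esub> s" "s \<rightarrow>\<^bsub>G\<^esub> p" "p \<noteq> r" "q \<noteq> s"
    and "z \<rightarrow>\<^bsub>G\<^esub> p" "z \<rightarrow>\<^bsub>G\<^esub> q" "z \<rightarrow>\<^bsub>G\<^esub> r" "z \<rightarrow>\<^bsub>G\<^esub> s"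
  shows "p \<rightarrow>\<^bsub>G\<^esub> r \<or> q \<rightarrow>\<^bsub>G\<^esub> s"
proof (rule ccontr)
  assume nadj: "\<not> ?thesis"
  let ?f = "case_sum (\<lambda>_::nat. z)
    (\<lambda>i::nat. if i = 0 then p else if i = 1 then q else if i = 2 then r else s)"
  have V: "pverts K1_join_C4 = {Inl 0, Inr 0, Inr 1, Inr 2, Inr 3}"
    by (auto simp: K1_join_C4_def graph_join_def disjoint_union_def complete_graph_def
        cycle_graph_def)
  have wf: "parcs K1_join_C4 \<subseteq> pverts K1_join_C4 \<times> pverts K1_join_C4"
    by (auto simp: K1_join_C4_def graph_join_def disjoint_union_def complete_graph_def
        cycle_graph_def)
  have E: "(Inl i, Inl j) \<notin> parcs K1_join_C4"
    "(Inl i, Inr j) \<in> parcs K1_join_C4 \<longleftrightarrow> i = 0 \<and> j < 4"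
    "(Inr j, Inl i) \<in> parcs K1_join_C4 \<longleftrightarrow> i = 0 \<and> j < 4"
    "(Inr i, Inr j) \<in> parcs K1_join_C4 \<longleftrightarrow>
      i < 4 \<and> j < 4 \<and> (j = Suc i mod 4 \<or> i = Suc j mod 4)" for i j
    by (auto simp: K1_join_C4_def graph_join_def disjoint_union_def complete_graph_def
        cycle_graph_def image_iff)
  note edges = \<open>p \<rightarrow>\<^bsub>G\<^esub> q\<close> \<open>q \<rightarrow>\<^bsub>G\<^esub> r\<close> \<open>r \<rightarrow>\<^bsub>G\<^esub> s\<close> \<open>s \<rightarrow>\<^bsub>G\<^esub> p\<close>
    \<open>z \<rightarrow>\<^bsub>G\<^esub> p\<close> \<open>z \<rightarrow>\<^bsub>G\<^esub> q\<close> \<open>z \<rightarrow>\<^bsub>G\<^esub> r\<close> \<open>z \<rightarrow>\<^bsub>G\<^esub> s\<close>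
  have non_edges: "\<not> p \<rightarrow>\<^bsub>G\<^esub> r" "\<not> q \<rightarrow>\<^bsub>G\<^esub> s" "\<not> r \<rightarrow>\<^bsub>G\<^esub> p" "\<not> s \<rightarrow>\<^bsub>G\<^esub> q"
    using nadj dominates_commute by blast+
  note adj = edges edges[THEN dominates_commute[THEN iffD1]] non_edges dominates_irrefl
  have neq: "p \<noteq> q" "q \<noteq> r" "r \<noteq> s" "s \<noteq> p" "z \<noteq> p" "z \<noteq> q" "z \<noteq> r" "z \<noteq> s"
    using assms dominates_irrefl by metis+
  have "\<not> free_of \<F> G"
  proof (rule not_free_ofI[where f = ?f])
    show "inj_on ?f (pverts K1_join_C4)"
      using neq assms by (auto simp: V inj_on_def)
    show "?f ` pverts K1_join_C4 \<subseteq> verts G"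
      using assms adj_in_verts by (auto simp: V)
    show "(u, v) \<in> parcs K1_join_C4 \<longleftrightarrow> ?f u \<rightarrow>\<^bsub>G\<^esub> ?f v"
      if "u \<in> pverts K1_join_C4" "v \<in> pverts K1_join_C4" for u v
      using that adj unfolding V by (elim insertE emptyE) (simp_all add: E)
  qed (use assms wf in auto)
  with free show False by blast
qed

lemma clique_card_le:
  assumes "clique G C"
  shows "card C \<le> clique_number G"
proof -
  have "{card C |C. clique G C} \<subseteq> card ` Pow (verts G)"
    by (auto simp: clique_def)
  then have "finite {card C |C. clique G C}"
    by (rule finite_subset) simp
  with assms show ?thesis
    unfolding clique_number_def by (auto intro: Max_ge)
qed

end

section \<open>Boundary points in a cyclic order\<close>

text \<open>A set closed under the cyclic successor contains the whole orbit of each of its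
  elements, which is \<open>{..<n}\<close>.\<close>

lemma cyclic_boundary_exists:
  assumes "S \<subseteq> {..<n}" "S \<noteq> {}" "S \<noteq> {..<n}"
  shows "\<exists>i\<in>S. Suc i mod n \<notin> S"
proof (rule ccontr)
  assume "\<not> ?thesis"
  then have closed: "Suc i mod n \<in> S" if "i \<in> S" for i
    using that by blast
  obtain i where i: "i \<in> S" using assms by blast
  have shift: "(i + k) mod n \<in> S" for k
  proof (induction k)
    case 0
    then show ?case using i assms(1) by auto
  next
    case (Suc k)
    then show ?case using closed[OF Suc] by (simp add: mod_Suc_eq)
  qed
  have "j \<in> S" if "j < n" for j
  proof -
    \<comment> \<open>Going once through \<open>n\<close> reaches \<open>j\<close> from
      \<open>i\<close> even if \<open>j < i\<close>; as \<open>i < n\<close>, the subtraction is not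
      truncated.\<close>
    have "i + (n - i + j) = n + j" using i assms(1) by auto
    then show ?thesis using shift[of "n - i + j"] that by simp
  qed
  with assms show False by blast
qed

section \<open>Non-neighbours in a maximum clique\<close>

theorem theorem2p9:
  fixes G :: "('a, 'b) pre_digraph"
  assumes "graph G"
    and "free_of {two_K2, K1_join_C4} G"
    and "clique_number G \<ge> 3"
  shows "chromatic_number G \<le> clique_number G + 1"
proof -
  interpret graph G by fact
  let ?n = "clique_number G"
  obtain A where A: "clique G A" "card A = ?n"
    using clique_number_attained by blast
  have fin: "finite A"
    using A(1) finite_verts by (auto simp: clique_def intro: finite_subset)
  have adjA: "u \<rightarrow>\<^bsub>G\<^esub> v" if "u \<in> A" "v \<in> A" "u \<noteq> v" for u v
    using A(1) that by (auto simp: clique_def)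
  \<comment> \<open>\<open>h\<close> is both the colouring of \<open>A\<close> and its cyclic
    order.\<close>
  obtain h where h: "bij_betw h A {..<?n}"
    using fin A(2) ex_bij_betw_finite_nat[of A] by (auto simp: atLeast0LessThan)
  then have inj_h: "inj_on h A" and im_h: "h ` A = {..<?n}"
    by (auto simp: bij_betw_def)
  define M where "M x = {v \<in> A. \<not> x \<rightarrow>\<^bsub>G\<^esub> v}" for x
  have M_sub: "M x \<subseteq> A" for x by (auto simp: M_def)
  \<comment> \<open>Otherwise \<open>x\<close> would extend the maximum clique.\<close>
  have M_ne: "M x \<noteq> {}" if "x \<in> verts G" "x \<notin> A" for x
  proof
    assume "M x = {}"
    then have "clique G (insert x A)"
      using A(1) that dominates_commute by (auto simp: clique_def M_def)
    from clique_card_le[OF this] show False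
      using A(2) fin that by simp
  qed
  have fin_M: "finite (M x)" for x
    using fin M_sub by (rule rev_finite_subset)
  have M_inter: "card (M x \<inter> M y) \<le> 1" if "x \<rightarrow>\<^bsub>G\<^esub> y" for x y
  proof -
    \<comment> \<open>Distinct \<open>u\<close>, \<open>v\<close> would form an edge of
      \<open>A\<close> with no edge to \<open>xy\<close>.\<close>
    have "u = v" if "u \<in> M x \<inter> M y" "v \<in> M x \<inter> M y" for u v
      using that two_K2_free_adjacent[OF assms(2) _ \<open>x \<rightarrow>\<^bsub>G\<^esub> y\<close>, of u v] adjA
      by (auto simp: M_def)
    then show ?thesis
      using fin_M by (simp add: card_le_Suc0_iff_eq)
  qed
  have M_union: "M x \<union> M y = A"
    if xy: "x \<rightarrow>\<^bsub>G\<^esub> y" "x \<notin> A" "y \<notin> A" and incomp: "\<not> M x \<subseteq> M y" "\<not> M y \<subseteq> M x" for x y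
  proof (rule ccontr)
    assume "M x \<union> M y \<noteq> A"
    then obtain z where z: "z \<in> A" "x \<rightarrow>\<^bsub>G\<^esub> z" "y \<rightarrow>\<^bsub>G\<^esub> z" using M_sub by (auto simp: M_def)
    obtain a b where ab: "a \<in> A" "\<not> x \<rightarrow>\<^bsub>G\<^esub> a" "y \<rightarrow>\<^bsub>G\<^esub> a" "b \<in> A" "\<not> y \<rightarrow>\<^bsub>G\<^esub> b" "x \<rightarrow>\<^bsub>G\<^esub> b"
      using incomp by (auto simp: M_def)
    \<comment> \<open>The 4-cycle is \<open>a b x y\<close>, its hub the common neighbour
      \<open>z\<close>; both chords are missing by the choice of \<open>a\<close> and
      \<open>b\<close>.\<close>
    have "a \<rightarrow>\<^bsub>G\<^esub> x \<or> b \<rightarrow>\<^bsub>G\<^esub> y"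
    proof (rule K1_join_C4_free_adjacent[OF assms(2)])
      show "a \<rightarrow>\<^bsub>G\<^esub> b" "z \<rightarrow>\<^bsub>G\<^esub> a" "z \<rightarrow>\<^bsub>G\<^esub> b"
        using adjA ab z by metis+
    qed (use ab z xy dominates_commute in auto)
    then show False using ab dominates_commute by blast
  qed
  have M_large: "M x \<union> M y = A"
    if "x \<rightarrow>\<^bsub>G\<^esub> y" "x \<notin> A" "y \<notin> A" "card (M x) \<ge> 2" "card (M y) \<ge> 2" for x y
  proof -
    have "\<not> M x \<subseteq> M y" "\<not> M y \<subseteq> M x"
      using that M_inter[OF that(1)] by (auto simp: Int_absorb1 Int_absorb2)
    with that show ?thesis using M_union by blast
  qed
  \<comment> \<open>If both sets are \<open>{a}\<close>, exchanging \<open>a\<close> for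
    \<open>x\<close> and \<open>y\<close> gives a clique with \<open>?n + 1\<close> vertices.
    Distinct singletons are incomparable, so \<open>M_union\<close> leaves \<open>A\<close> with
    only two vertices.\<close>
  have M_single: "card (M y) \<noteq> 1"
    if xy: "x \<rightarrow>\<^bsub>G\<^esub> y" "x \<notin> A" "y \<notin> A" and "card (M x) = 1" for x y
  proof
    assume "card (M y) = 1"
    with \<open>card (M x) = 1\<close> obtain a b where ab: "M x = {a}" "M y = {b}"
      by (meson card_1_singletonE)
    show False
    proof (cases "a = b")
      case True
      have a: "a \<in> A" using ab M_sub by blast
      have adj: "x \<rightarrow>\<^bsub>G\<^esub> v" "y \<rightarrow>\<^bsub>G\<^esub> v" if "v \<in> A - {a}" for v
        using that ab True by (auto simp: M_def)
      have "clique G (insert x (insert y (A - {a})))"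
        using A(1) xy adj dominates_commute adj_in_verts unfolding clique_def by blast
      then have "card (insert x (insert y (A - {a}))) \<le> ?n"
        by (rule clique_card_le)
      moreover have "x \<noteq> y" using xy dominates_irrefl by blast
      moreover have "card (A - {a}) = ?n - 1" using a A(2) fin by simp
      ultimately show False
        using xy fin assms(3) by simp
    next
      case False
      then have "A = {a, b}" using M_union[OF xy] ab by auto
      then show False using A(2) assms(3) False by simp
    qed
  qed

  \<comment> \<open>The colouring\<close>
  have "\<exists>i\<in>h ` M x. M x = A \<or> Suc i mod ?n \<notin> h ` M x" if "M x \<noteq> {}" for x
  proof (cases "M x = A")
    case True
    with that show ?thesis by auto
  next
    case False
    then have "h ` M x \<noteq> {..<?n}"
      using inj_on_image_eq_iff[OF inj_h M_sub order.refl] im_h by metis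
    then show ?thesis
      using cyclic_boundary_exists[of "h ` M x" ?n] that M_sub im_h by blast
  qed
  then obtain f where f: "f x \<in> h ` M x" "M x = A \<or> Suc (f x) mod ?n \<notin> h ` M x"
    if "M x \<noteq> {}" for x
    by metis
  \<comment> \<open>The values of \<open>h\<close> and, outside \<open>A\<close>, of
    \<open>f\<close> lie below \<open>?n\<close>, so \<open>?n\<close> is the extra colour.\<close>
  define c where "c x = (if x \<in> A then h x else if card (M x) = 1 then ?n else f x)" for x
  have h_less: "h v < ?n" if "v \<in> A" for v using im_h that by blast
  have f_M: "\<exists>v\<in>A. f x = h v \<and> \<not> x \<rightarrow>\<^bsub>G\<^esub> v" if "x \<in> verts G" "x \<notin> A" for x
    using f(1)[OF M_ne[OF that]] by (auto simp: M_def)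
  have f_less: "f x < ?n" if "x \<in> verts G" "x \<notin> A" for x
    using f_M[OF that] h_less by force
  \<comment> \<open>\<open>f x\<close> is the colour of a non-neighbour of \<open>x\<close> in
    \<open>A\<close>, and \<open>h\<close> is injective.\<close>
  have f_A: "f x \<noteq> h v" if "x \<in> verts G" "x \<notin> A" "v \<in> A" "x \<rightarrow>\<^bsub>G\<^esub> v" for x v
    using f_M[OF that(1,2)] that(3,4) inj_h by (metis inj_onD)
  have card_M: "card (M x) \<ge> 2" if "x \<in> verts G" "x \<notin> A" "card (M x) \<noteq> 1" for x
  proof -
    have "card (M x) \<noteq> 0" using M_ne[OF that(1,2)] fin_M by simp
    with that(3) show ?thesis by simp
  qed
  have f_neq: "f x \<noteq> f y"
    if xy: "x \<rightarrow>\<^bsub>G\<^esub> y" "x \<notin> A" "y \<notin> A" "card (M x) \<noteq> 1" "card (M y) \<noteq> 1" for x y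
  proof
    assume eq: "f x = f y"
    have V: "x \<in> verts G" "y \<in> verts G" using xy adj_in_verts by auto
    note ge = card_M[OF V(1) xy(2,4)] card_M[OF V(2) xy(3,5)]
    have U: "M x \<union> M y = A" using M_large[OF xy(1-3) ge] .
    \<comment> \<open>If one set were \<open>A\<close>, the intersection would be the other, which
      has at least two elements. Hence \<open>f x\<close> and \<open>f y\<close> are true boundary
      positions.\<close>
    have "M x \<noteq> A" "M y \<noteq> A"
      using M_inter[OF xy(1)] ge M_sub[of x] M_sub[of y] by (auto simp: Int_absorb1 Int_absorb2)
    then have "Suc (f x) mod ?n \<notin> h ` M x" "Suc (f x) mod ?n \<notin> h ` M y"
      using f(2) M_ne V xy eq by metis+
    then have "Suc (f x) mod ?n \<notin> h ` A" using U by blast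
    then show False using im_h assms(3) by simp
  qed
  have "proper_colouring G (?n + 1) c"
    unfolding proper_colouring_def
  proof (intro conjI allI impI subsetI)
    fix i assume "i \<in> c ` verts G"
    then show "i \<in> {..<?n + 1}"
      using h_less f_less by (auto simp: c_def less_Suc_eq)
  next
    fix x y assume xy: "x \<rightarrow>\<^bsub>G\<^esub> y"
    then have V: "x \<in> verts G" "y \<in> verts G" "y \<rightarrow>\<^bsub>G\<^esub> x" "x \<noteq> y"
      using adj_in_verts dominates_commute dominates_irrefl by auto
    show "c x \<noteq> c y"
    proof (cases "x \<in> A"; cases "y \<in> A")
      assume "x \<in> A" "y \<in> A"
      then show ?thesis using V inj_h by (auto simp: c_def dest: inj_onD)
    next
      assume "x \<in> A" "y \<notin> A"
      then show ?thesis using V f_A[of y x] h_less[of x] by (auto simp: c_def)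
    next
      assume "x \<notin> A" "y \<in> A"
      then show ?thesis using V xy f_A[of x y] h_less[of y] by (auto simp: c_def)
    next
      \<comment> \<open>\<open>M_single\<close> excludes that both have the extra colour,
        \<open>f_less\<close> separates it from the values of \<open>f\<close>, and
        \<open>f_neq\<close> treats two values of \<open>f\<close>.\<close>
      assume "x \<notin> A" "y \<notin> A"
      then show ?thesis
        using V xy M_single[of x y] f_neq[of x y] f_less[of x] f_less[of y]
        by (auto simp: c_def)
    qed
  qed
  then show ?thesis
    unfolding chromatic_number_def by (intro Least_le exI)
qed

end
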